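(* Let $k\ge 3$ and $n\ge 1$ be integers, and let $\mathcal{S}(n,k)$ be the Sierpiński graph, with $N_n=k^n$ vertices. The first-order network coherence of $\mathcal{S}(n,k)$ is $$H_1(\mathcal{S}(n,k))=\frac{(k^2+k+2)(k-1)(k+2)^n-4k}{4k^{n+1}(k+1)(k+2)}-\frac{(k-2)(k+1)}{4k(k+2)}.$$ Moreover, for fixed $k$, as $n\to\infty$, $$H_1(\mathcal{S}(n,k))\sim \frac{k^3+k-2}{4k(k+1)(k+2)}\,N_n^{\frac{\log (k+2)}{\log k}-1},$$ i.e. the ratio of the two sides tends to $1$.
   Context: Sierpiński graphs: for $n\ge 1$ and $k\ge 3$, $\mathcal{S}(n,k)$ has vertex set $\{1,2,\dots,k\}^n$, and two vertices $p=p_1p_2\cdots p_n$ and $q=q_1q_2\cdots q_n$ are adjacent if and only if there is an integer $h$, $1\le h\le n$, such that (a) $p_i=q_i$ for $1\le i\le h-1$; (b) $p_h\ne q_h$; (c) $p_i=q_h$ and $q_i=p_h$ for $h+1\le i\le n$. First-order network coherence: let $\mathcal{G}$ be a connected undirected graph with $N$ vertices and Laplacian matrix $\mathbf{L}=\mathbf{D}-\mathbf{A}$ (degree matrix minus adjacency matrix), with eigenvalues $0=\lambda_1<\lambda_2\le\cdots\le\lambda_N$. Consider the noisy consensus dynamics $\dot x(t)=-\mathbf{L}x(t)+w(t)$, where $w(t)\in\mathbb{R}^N$ is zero-mean, unit-variance white noise with independent components, and $\sum_i x_i(0)=0$. The first-order network coherence $H_1(\mathcal{G})$ is the mean steady-state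 variance of the deviation from the average, $H_1(\mathcal{G})=\frac1N\sum_{i=1}^N\lim_{t\to\infty}\mathbf{E}\big\{\big(x_i(t)-\frac1N\sum_{j=1}^N x_j(t)\big)^2\big\}$. It is a known fact, which may be taken as the definition of $H_1$, that $H_1(\mathcal{G})=\frac{1}{2N}\sum_{i=2}^{N}\frac{1}{\lambda_i}$. *)

theory Defs
  imports
    "HOL-Library.Landau_Symbols"
    "Jordan_Normal_Form.Char_Poly"
    "Graph_Theory.Pair_Digraph"
begin

(* A simple undirected graph is a pair_graph: a finite loop-free digraph with symmetric arcs. *)

text \<open>
  Words are lists and positions count from 0: the position \<open>h\<close> below is one less
  than in the usual definition over \<open>p\<^sub>1 \<dots> p\<^sub>n\<close>.
\<close>

definition sierpinski_adj :: "nat \<Rightarrow> nat list \<Rightarrow> nat list \<Rightarrow> bool" where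
  "sierpinski_adj n p q \<longleftrightarrow>
     (\<exists>h<n. (\<forall>i<h. p ! i = q ! i) \<and>
            p ! h \<noteq> q ! h \<and>
            (\<forall>i. h < i \<and> i < n \<longrightarrow> p ! i = q ! h \<and> q ! i = p ! h))"

definition sierpinski_vertices :: "nat \<Rightarrow> nat \<Rightarrow> nat list set" where
  "sierpinski_vertices n k = {p. set p \<subseteq> {1..k} \<and> length p = n}"

definition sierpinski :: "nat \<Rightarrow> nat \<Rightarrow> nat list pair_pre_digraph" where
  "sierpinski n k =
     \<lparr> pverts = sierpinski_vertices n k,
       parcs = {(p, q). p \<in> sierpinski_vertices n k \<and> q \<in> sierpinski_vertices n k \<and>
                        sierpinski_adj n p q} \<rparr>"

lemma card_pverts_sierpinski: "card (pverts (sierpinski n k)) = k ^ n"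
  by (simp add: sierpinski_def sierpinski_vertices_def card_lists_length_eq)

lemma pair_graph_sierpinski: "pair_graph (sierpinski n k)"
proof
  show "finite (pverts (sierpinski n k))"
    by (simp add: sierpinski_def sierpinski_vertices_def finite_lists_length_eq)
  moreover have "parcs (sierpinski n k) \<subseteq> pverts (sierpinski n k) \<times> pverts (sierpinski n k)"
    by (auto simp: sierpinski_def)
  ultimately show "finite (parcs (sierpinski n k))"
    by (meson finite_SigmaI finite_subset)
  show "symmetric (with_proj (sierpinski n k))"
  proof -
    have "sierpinski_adj n q p" if "sierpinski_adj n p q" for p q
      using that unfolding sierpinski_adj_def by (elim exE conjE) (rule exI, intro conjI, assumption, simp_all)
    then have "sym (parcs (sierpinski n k))"
      by (auto simp: sierpinski_def intro!: symI)
    then show ?thesis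
      by (simp add: symmetric_def arcs_ends_def arc_to_ends_def)
  qed
qed (auto simp: sierpinski_def sierpinski_adj_def)

text \<open>
  Matrices are indexed by numbers, so the vertices have to be enumerated; the
  characteristic polynomial does not depend on the enumeration (see \<open>char_poly_laplacian_mat\<close>).
\<close>

definition adjacency_mat :: "'a pair_pre_digraph \<Rightarrow> 'a list \<Rightarrow> real mat" where
  "adjacency_mat G vs = mat (length vs) (length vs)
     (\<lambda>(i, j). if (vs ! i, vs ! j) \<in> parcs G then 1 else 0)"

definition degree_mat :: "'a pair_pre_digraph \<Rightarrow> 'a list \<Rightarrow> real mat" where
  "degree_mat G vs = mat (length vs) (length vs)
     (\<lambda>(i, j). if i = j then real (out_degree (with_proj G) (vs ! i)) else 0)"

definition laplacian_mat :: "'a pair_pre_digraph \<Rightarrow> 'a list \<Rightarrow> real mat" where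
  "laplacian_mat G vs = degree_mat G vs - adjacency_mat G vs"

definition vertex_enum :: "'a pair_pre_digraph \<Rightarrow> 'a list" where
  "vertex_enum G = (SOME vs. distinct vs \<and> set vs = pverts G)"

lemma vertex_enum:
  assumes "finite (pverts G)"
  shows "distinct (vertex_enum G)" and "set (vertex_enum G) = pverts G"
proof -
  have "\<exists>vs. distinct vs \<and> set vs = pverts G"
    using finite_distinct_list[OF assms] by blast
  from someI_ex[OF this]
  show "distinct (vertex_enum G)" and "set (vertex_enum G) = pverts G"
    by (simp_all add: vertex_enum_def)
qed

lemma char_poly_laplacian_mat:
  assumes "distinct vs" "distinct ws" "set vs = pverts G" "set ws = pverts G"
  shows "char_poly (laplacian_mat G vs) = char_poly (laplacian_mat G ws)"
proof -
  define N where "N = length vs"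
  have N: "length ws = N"
    using assms by (metis N_def distinct_card)
  have "\<exists>j<N. vs ! j = ws ! i" if "i < N" for i
    using that assms N by (metis N_def in_set_conv_nth nth_mem)
  then obtain f where f: "\<And>i. i < N \<Longrightarrow> f i < N" "\<And>i. i < N \<Longrightarrow> vs ! f i = ws ! i"
    by metis
  have inj: "f i = f j \<longleftrightarrow> i = j" if "i < N" "j < N" for i j
    using that f assms(2) N by (metis nth_eq_iff_index_eq)
  have "inj_on f {..<N}" "f ` {..<N} \<subseteq> {..<N}"
    using inj f(1) by (auto simp: inj_on_def)
  then have surj: "f ` {..<N} = {..<N}"
    by (simp add: endo_inj_surj)
  define P :: "real mat" where "P = mat N N (\<lambda>(i, j). if j = f i then 1 else 0)"
  define Q :: "real mat" where "Q = mat N N (\<lambda>(i, j). if i = f j then 1 else 0)"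
  define A where "A = laplacian_mat G vs"
  define B where "B = laplacian_mat G ws"
  have car: "P \<in> carrier_mat N N" "Q \<in> carrier_mat N N" "A \<in> carrier_mat N N" "B \<in> carrier_mat N N"
    using N by (auto simp: P_def Q_def A_def B_def laplacian_mat_def degree_mat_def adjacency_mat_def
        N_def)
  have AB: "B $$ (i, j) = A $$ (f i, f j)" if "i < N" "j < N" for i j
    using that f inj[OF that] N
    by (auto simp: A_def B_def laplacian_mat_def degree_mat_def adjacency_mat_def N_def[symmetric])
  have PQ: "P * Q = 1\<^sub>m N"
  proof (rule eq_matI)
    fix i j assume ij: "i < dim_row (1\<^sub>m N :: real mat)" "j < dim_col (1\<^sub>m N :: real mat)"
    then have "(P * Q) $$ (i, j) =
        (\<Sum>l\<in>{0..<N}. (if l = f i then 1 else 0) * (if l = f j then 1 else 0))"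
      by (simp add: P_def Q_def scalar_prod_def)
    also have "\<dots> = (\<Sum>l\<in>{0..<N}. if l = f i then (if f i = f j then 1 else 0) else 0)"
      by (rule sum.cong) auto
    also have "\<dots> = (if f i = f j then 1 else 0)"
      using f(1) ij by (simp add: sum.delta)
    finally show "(P * Q) $$ (i, j) = 1\<^sub>m N $$ (i, j)"
      using ij inj by simp
  qed (simp_all add: P_def Q_def)
  have QP: "Q * P = 1\<^sub>m N"
    by (rule mat_mult_left_right_inverse[OF car(1,2) PQ])
  have PA: "(P * A) $$ (i, j) = A $$ (f i, j)" if "i < N" "j < N" for i j
  proof -
    have "(P * A) $$ (i, j) = (\<Sum>l\<in>{0..<N}. (if l = f i then 1 else 0) * A $$ (l, j))"
      using that car by (simp add: P_def scalar_prod_def)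
    also have "\<dots> = (\<Sum>l\<in>{0..<N}. if l = f i then A $$ (f i, j) else 0)"
      by (rule sum.cong) auto
    also have "\<dots> = A $$ (f i, j)"
      using f(1) that by (simp add: sum.delta)
    finally show ?thesis .
  qed
  have "B = P * A * Q"
  proof (rule eq_matI)
    fix i j assume "i < dim_row (P * A * Q)" "j < dim_col (P * A * Q)"
    then have ij: "i < N" "j < N"
      using car by auto
    obtain C where C: "C = P * A" "C \<in> carrier_mat N N"
      using car by simp
    have "(C * Q) $$ (i, j) = (\<Sum>l\<in>{0..<N}. C $$ (i, l) * (if l = f j then 1 else 0))"
      using ij C(2) by (simp add: Q_def scalar_prod_def)
    then have "(P * A * Q) $$ (i, j) = (\<Sum>l\<in>{0..<N}. (P * A) $$ (i, l) * (if l = f j then 1 else 0))"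
      by (simp only: C(1))
    also have "\<dots> = (\<Sum>l\<in>{0..<N}. if l = f j then A $$ (f i, f j) else 0)"
      using PA ij f(1) by (intro sum.cong) auto
    also have "\<dots> = A $$ (f i, f j)"
      using f(1) ij by (simp add: sum.delta)
    finally show "B $$ (i, j) = (P * A * Q) $$ (i, j)"
      using AB ij by simp
  qed (use car in auto)
  then have "similar_mat_wit B A P Q"
    using car PQ QP by (intro similar_mat_witI[where n = N]) simp_all
  then have "similar_mat B A"
    unfolding similar_mat_def by blast
  then show ?thesis
    using char_poly_similar unfolding A_def B_def by metis
qed

text \<open>
  \<open>laplacian_eigenvalue G i\<close> is the \<open>i\<close>-th smallest eigenvalue (multiplicities counted,
  \<open>1 \<le> i \<le> N\<close>); since the Laplacian matrix of an undirected graph is symmetric, all its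
  eigenvalues are real and the list has length \<open>N\<close>.
\<close>

definition laplacian_spectrum :: "'a pair_pre_digraph \<Rightarrow> real list" where
  "laplacian_spectrum G =
     sorted_list_of_multiset (proots (char_poly (laplacian_mat G (vertex_enum G))))"

definition laplacian_eigenvalue :: "'a pair_pre_digraph \<Rightarrow> nat \<Rightarrow> real" where
  "laplacian_eigenvalue G i = laplacian_spectrum G ! (i - 1)"

text \<open>
  The first-order coherence, meant for connected undirected graphs, where only the first
  eigenvalue vanishes.
\<close>

definition network_coherence :: "'a pair_pre_digraph \<Rightarrow> real" where
  "network_coherence G =
     (let N = card (pverts G) in 1 / (2 * real N) * (\<Sum>i=2..N. 1 / laplacian_eigenvalue G i))"

end

(*
If a matrix G satisfies L G = I - J/N and has constant row sums c, then G differs from the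
pseudo-inverse of the Laplacian L by a matrix with equal rows of sum c, so the sum of 1/lambda
over the nonzero eigenvalues is tr G - c. To avoid diagonalising L, add a column of ones to L: this
turns the eigenvalue 0 into 1, keeps the others, and makes the matrix invertible with an
explicit inverse whose trace is read off a Schur form.

For Sierpinski graphs such a G is found by recursion on n. Replacing every vertex of S(n,k) by
a k-clique gives S(n+1,k), so its Laplacian is a linear combination of I, a permutation
involution and E E^T (E the incidence matrix of vertices and cliques), and the Woodbury formula
expresses G(n+1) through G(n). Taking row sums and traces gives linear recurrences with ratio
k+2.
*)

theory Submission
  imports Defs "Jordan_Normal_Form.Schur_Decomposition"
begin

section \<open>Linear algebra: traces of inverses and characteristic polynomials\<close>

text \<open>Back substitution: the determinant rules out zeros on the diagonal of \<open>B\<close>,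
  so \<open>C\<close> is upper triangular too, and the \<open>(i, i)\<close> entry of
  \<open>B * C\<close> reduces to a single product.\<close>

lemma upper_triangular_right_inverse_diag:
  fixes B :: "'a :: field mat"
  assumes B: "B \<in> carrier_mat n n" and C: "C \<in> carrier_mat n n"
    and ut: "upper_triangular B" and BC: "B * C = 1\<^sub>m n" and i: "i < n"
  shows "B $$ (i, i) * C $$ (i, i) = 1"
proof -
  have "det B * det C = 1"
    using BC B C by (metis det_mult det_one)
  then have "det B \<noteq> 0" by auto
  then have "prod_list (diag_mat B) \<noteq> 0"
    using det_upper_triangular[OF ut B] by simp
  then have diag: "B $$ (i, i) \<noteq> 0" if "i < n" for i
    using that B by (auto simp: diag_mat_def prod_list_zero_iff)
  have entry: "(\<Sum>l\<in>{i..<n}. B $$ (i, l) * C $$ (l, j)) = (if i = j then 1 else 0)"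
    if "i < n" "j < n" for i j
  proof -
    have "(if i = j then 1 else 0) = (B * C) $$ (i, j)"
      using that BC by simp
    also have "\<dots> = (\<Sum>l\<in>{0..<n}. B $$ (i, l) * C $$ (l, j))"
      using that B C by (simp add: scalar_prod_def)
    also have "\<dots> = (\<Sum>l\<in>{i..<n}. B $$ (i, l) * C $$ (l, j))"
      using that B ut by (intro sum.mono_neutral_right) (auto simp: upper_triangular_def)
    finally show ?thesis by simp
  qed
  \<comment> \<open>Rows are cleared from the last one upwards, since row \<open>i\<close> of
    \<open>B\<close> only meets the rows of \<open>C\<close> from \<open>i\<close> on.\<close>
  have below: "j < i \<longrightarrow> C $$ (i, j) = 0" if "i < n" for i j
    using that
  proof (induction "n - i" arbitrary: i rule: less_induct)
    case less
    show ?case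
    proof
      assume ji: "j < i"
      have "(\<Sum>l\<in>{i..<n}. B $$ (i, l) * C $$ (l, j))
          = B $$ (i, i) * C $$ (i, j) + (\<Sum>l\<in>{Suc i..<n}. B $$ (i, l) * C $$ (l, j))"
        using less.prems by (simp add: sum.atLeast_Suc_lessThan)
      also have "(\<Sum>l\<in>{Suc i..<n}. B $$ (i, l) * C $$ (l, j)) = 0"
        using less.hyps ji less.prems by (intro sum.neutral) auto
      finally show "C $$ (i, j) = 0"
        using entry[of i j] ji less.prems diag[of i] by simp
    qed
  qed
  have "(\<Sum>l\<in>{i..<n}. B $$ (i, l) * C $$ (l, i))
      = B $$ (i, i) * C $$ (i, i) + (\<Sum>l\<in>{Suc i..<n}. B $$ (i, l) * C $$ (l, i))"
    using i by (simp add: sum.atLeast_Suc_lessThan)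
  also have "(\<Sum>l\<in>{Suc i..<n}. B $$ (i, l) * C $$ (l, i)) = 0"
    using below by (intro sum.neutral) auto
  finally show "B $$ (i, i) * C $$ (i, i) = 1"
    using entry[of i i] i by simp
qed

lemma sum_diag_mult_commute:
  fixes A :: "'a :: comm_semiring_0 mat"
  assumes A: "A \<in> carrier_mat n m" and B: "B \<in> carrier_mat m n"
  shows "(\<Sum>i<n. (A * B) $$ (i, i)) = (\<Sum>i<m. (B * A) $$ (i, i))"
proof -
  have "(\<Sum>i<n. (A * B) $$ (i, i)) = (\<Sum>i<n. \<Sum>j<m. A $$ (i, j) * B $$ (j, i))"
    using A B by (intro sum.cong) (auto simp: scalar_prod_def lessThan_atLeast0)
  also have "\<dots> = (\<Sum>j<m. \<Sum>i<n. B $$ (j, i) * A $$ (i, j))"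
    by (subst sum.swap) (simp add: mult.commute)
  also have "\<dots> = (\<Sum>i<m. (B * A) $$ (i, i))"
    using A B by (intro sum.cong) (auto simp: scalar_prod_def lessThan_atLeast0)
  finally show ?thesis .
qed

text \<open>A Schur form \<open>B\<close> of \<open>A\<close> carries \<open>es\<close> on its
  diagonal, and the same similarity turns \<open>X\<close> into a right inverse of \<open>B\<close>
  with unchanged trace. The diagonal entries of the two are mutually inverse, which also excludes
  the eigenvalue 0.\<close>

lemma sum_diag_inverse_eq_sum_inverse_eigenvalues:
  fixes A :: "'a :: conjugatable_ordered_field mat"
  assumes A: "A \<in> carrier_mat n n" and X: "X \<in> carrier_mat n n"
    and AX: "A * X = 1\<^sub>m n"
    and es: "char_poly A = (\<Prod>e\<leftarrow>es. [:- e, 1:])"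
  shows "(\<Sum>i<n. X $$ (i, i)) = (\<Sum>e\<leftarrow>es. 1 / e)" and "0 \<notin> set es"
proof -
  obtain B P Q where "schur_decomposition A es = (B, P, Q)"
    by (cases "schur_decomposition A es") auto
  then have wit: "similar_mat_wit A B P Q" and ut: "upper_triangular B" and dg: "diag_mat B = es"
    using schur_decomposition[OF A es] by auto
  note sim = similar_mat_witD2[OF A wit]
  define C where "C = Q * X * P"
  have C: "C \<in> carrier_mat n n" using sim X by (auto simp: C_def)
  have "B = Q * A * P"
    using similar_mat_witD(3)[OF _ similar_mat_wit_sym[OF wit]] by blast
  then have "B * C = Q * A * P * (Q * X * P)" by (simp add: C_def)
  also have "\<dots> = Q * A * (P * Q) * X * P"
    using sim X by (simp add: assoc_mult_mat[of _ n n _ n _ n])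
  also have "\<dots> = Q * (A * X) * P"
    using sim X by (simp add: assoc_mult_mat[of _ n n _ n _ n])
  also have "\<dots> = 1\<^sub>m n"
    using sim AX by simp
  finally have BC: "B * C = 1\<^sub>m n" .
  note inv = upper_triangular_right_inverse_diag[OF sim(5) C ut BC]
  have "(\<Sum>i<n. C $$ (i, i)) = (\<Sum>i<n. (P * (Q * X)) $$ (i, i))"
    unfolding C_def using sim X by (intro sum_diag_mult_commute) auto
  also have "P * (Q * X) = X"
    using sim X by (simp add: assoc_mult_mat[of P n n Q n X n, symmetric])
  finally have "(\<Sum>i<n. X $$ (i, i)) = (\<Sum>i<n. C $$ (i, i))" by simp
  also have "\<dots> = (\<Sum>i<n. 1 / B $$ (i, i))"
    by (intro sum.cong)
      (auto, metis inv mult_zero_left nonzero_mult_div_cancel_left zero_neq_one)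
  also have "\<dots> = (\<Sum>e\<leftarrow>es. 1 / e)"
    using sim by (simp add: dg[symmetric] diag_mat_def interv_sum_list_conv_sum_set_nat
        lessThan_atLeast0 o_def)
  finally show "(\<Sum>i<n. X $$ (i, i)) = (\<Sum>e\<leftarrow>es. 1 / e)" .
  show "0 \<notin> set es"
    using inv sim by (force simp: dg[symmetric] diag_mat_def)
qed

text \<open>The polynomial splits over the complex numbers. Its roots are real by symmetry, and the
  factorization is pulled back along the injective embedding of coefficients.\<close>

lemma symmetric_real_mat_char_poly_factorized:
  fixes A :: "real mat"
  assumes A: "A \<in> carrier_mat n n"
    and sym: "\<And>i j. i < n \<Longrightarrow> j < n \<Longrightarrow> A $$ (i, j) = A $$ (j, i)"
  obtains as where "char_poly A = (\<Prod>a\<leftarrow>as. [:- a, 1:])"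
proof -
  define Z :: "complex mat" where "Z = map_mat of_real A"
  have Z: "Z \<in> carrier_mat n n" using A by (simp add: Z_def)
  interpret of_real_poly: map_poly_inj_comm_ring_hom "of_real :: real \<Rightarrow> complex" ..
  obtain zs where zs: "char_poly Z = (\<Prod>z\<leftarrow>zs. [:- z, 1:])"
    using char_poly_factorized[OF Z] by blast
  have "z \<in> \<real>" if "z \<in> set zs" for z
  proof -
    have "poly (char_poly Z) z = 0"
      using that by (auto simp: zs poly_prod_list prod_list_zero_iff)
    then obtain v where v: "v \<in> carrier_vec n" "v \<noteq> 0\<^sub>v n" "Z *\<^sub>v v = z \<cdot>\<^sub>v v"
      using eigenvalue_root_char_poly[OF Z] Z by (auto simp: eigenvalue_def eigenvector_def)
    \<comment> \<open>\<open>S\<close> is the Hermitian form of \<open>A\<close> at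
      \<open>v\<close>: it equals \<open>z\<close> times the squared norm of \<open>v\<close>, and
      symmetry of \<open>A\<close> makes it its own conjugate.\<close>
    define S where "S = (\<Sum>i<n. \<Sum>j<n. of_real (A $$ (i, j)) * (cnj (v $ i) * v $ j))"
    have Zv: "z * v $ i = (\<Sum>j<n. of_real (A $$ (i, j)) * v $ j)" if "i < n" for i
    proof -
      have "z * v $ i = (Z *\<^sub>v v) $ i" using v that by simp
      also have "\<dots> = (\<Sum>j<n. of_real (A $$ (i, j)) * v $ j)"
        using A v(1) that by (simp add: Z_def scalar_prod_def lessThan_atLeast0)
      finally show ?thesis .
    qed
    have "S = (\<Sum>i<n. cnj (v $ i) * (z * v $ i))"
      by (simp add: S_def Zv sum_distrib_left mult_ac)
    also have "\<dots> = z * (\<Sum>i<n. cnj (v $ i) * v $ i)"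
      by (simp add: sum_distrib_left mult_ac)
    also have "(\<Sum>i<n. cnj (v $ i) * v $ i) = of_real (\<Sum>i<n. (cmod (v $ i))\<^sup>2)"
      by (simp add: complex_norm_square mult.commute flip: of_real_power)
    finally have Sz: "S = z * of_real (\<Sum>i<n. (cmod (v $ i))\<^sup>2)" .
    have "cnj S = (\<Sum>i<n. \<Sum>j<n. of_real (A $$ (i, j)) * (v $ i * cnj (v $ j)))"
      by (simp add: S_def)
    also have "\<dots> = S"
      unfolding S_def using sym by (subst sum.swap) (auto intro!: sum.cong)
    finally have "S \<in> \<real>" by (simp add: complex_is_Real_iff complex_eq_iff)
    moreover have "(\<Sum>i<n. (cmod (v $ i))\<^sup>2) \<noteq> 0"
    proof
      assume "(\<Sum>i<n. (cmod (v $ i))\<^sup>2) = 0"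
      then have "v $ i = 0" if "i < n" for i
        using that by (subst (asm) sum_nonneg_eq_0_iff) auto
      then show False using v by auto
    qed
    ultimately show "z \<in> \<real>"
      using Sz by (metis Reals_divide Reals_of_real nonzero_mult_div_cancel_right of_real_eq_0_iff)
  qed
  then have "map (of_real \<circ> Re) zs = zs"
    by (intro map_idI) auto
  then have "char_poly Z = (\<Prod>a\<leftarrow>map (of_real \<circ> Re) zs. [:- a, 1:])"
    by (simp add: zs)
  also have "\<dots> = map_poly of_real (\<Prod>a\<leftarrow>map Re zs. [:- a, 1:])"
    by (simp add: of_real_poly.hom_prod_list hom_distribs o_def del: of_real_poly.prod_list_map_hom)
  finally have "map_poly of_real (\<Prod>a\<leftarrow>map Re zs. [:- a, 1:]) = char_poly Z" ..
  also have "\<dots> = map_poly of_real (char_poly A)"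
    unfolding Z_def by (rule of_real_hom.char_poly_hom[OF A])
  finally have "char_poly A = (\<Prod>a\<leftarrow>map Re zs. [:- a, 1:])"
    by simp
  then show thesis by (rule that)
qed

text \<open>With zero row sums, \<open>x I - L\<close> maps the all-ones vector to \<open>x\<close>
  times itself, so subtracting a column of ones is right multiplication by a matrix of determinant
  \<open>1 - 1 / x\<close>. The linear factors clear this denominator.\<close>

lemma char_poly_add_ones_column:
  fixes L :: "'a :: field_char_0 mat"
  assumes L: "L \<in> carrier_mat n n" and n: "0 < n"
    and rows: "\<And>i. i < n \<Longrightarrow> (\<Sum>j<n. L $$ (i, j)) = 0"
  shows "[:0, 1:] * char_poly (L + mat n n (\<lambda>(i, j). if j = 0 then 1 else 0))
    = [:- 1, 1:] * char_poly L"
proof -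
  define K where "K = L + mat n n (\<lambda>(i, j). if j = 0 then 1 else (0 :: 'a))"
  have K: "K \<in> carrier_mat n n" using L by (simp add: K_def)
  have "x * poly (char_poly K) x = (x - 1) * poly (char_poly L) x" for x
  proof (cases "x = 0")
    case True
    \<comment> \<open>At \<open>x = 0\<close> the left side vanishes; so does the right side,
      because the all-ones vector lies in the kernel of \<open>L\<close>.\<close>
    have "L *\<^sub>v vec n (\<lambda>_. 1) = 0 \<cdot>\<^sub>v vec n (\<lambda>_. 1)"
      using L rows by (intro eq_vecI) (auto simp: scalar_prod_def lessThan_atLeast0)
    moreover have "vec n (\<lambda>_. 1) \<noteq> (0\<^sub>v n :: 'a vec)"
      using n by (metis index_vec index_zero_vec(1) zero_neq_one)
    ultimately have "eigenvalue L 0"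
      using L unfolding eigenvalue_def eigenvector_def by (intro exI[of _ "vec n (\<lambda>_. 1)"]) auto
    then show ?thesis
      using True eigenvalue_root_char_poly[OF L] by simp
  next
    case False
    \<comment> \<open>\<open>W\<close> is the identity minus a column of constants
      \<open>1 / x\<close>; \<open>M\<close> maps these constants to the ones by which
      \<open>K\<close> and \<open>L\<close> differ.\<close>
    define W where "W = mat n n (\<lambda>(i, j). (if i = j then 1 else 0) - (if j = 0 then 1 / x else 0))"
    define M where "M = - char_matrix L x"
    have W: "W \<in> carrier_mat n n" and M: "M \<in> carrier_mat n n"
      using L by (auto simp: W_def M_def)
    have Mrow: "(\<Sum>l<n. M $$ (i, l)) = x" if "i < n" for i
    proof -
      have "(\<Sum>l<n. M $$ (i, l)) = (\<Sum>l<n. (if i = l then x else 0) - L $$ (i, l))"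
        using that L by (intro sum.cong) (auto simp: M_def char_matrix_def)
      also have "\<dots> = x"
        using that rows by (simp add: sum_subtractf)
      finally show ?thesis .
    qed
    have "- char_matrix K x = M * W"
    proof (rule eq_matI)
      fix i j assume "i < dim_row (M * W)" "j < dim_col (M * W)"
      then have ij: "i < n" "j < n" using M W by auto
      have "(M * W) $$ (i, j) =
          (\<Sum>l<n. M $$ (i, l) * ((if l = j then 1 else 0) - (if j = 0 then 1 / x else 0)))"
        using ij M W by (simp add: scalar_prod_def W_def lessThan_atLeast0)
      also have "\<dots> = (\<Sum>l<n. (if l = j then M $$ (i, l) else 0)
          - M $$ (i, l) * (if j = 0 then 1 / x else 0))"
        by (intro sum.cong) (auto simp: algebra_simps)
      also have "\<dots> = M $$ (i, j) - (if j = 0 then 1 else 0)"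
        using ij False Mrow[of i] by (simp add: sum_subtractf flip: sum_distrib_right sum_divide_distrib)
      also have "\<dots> = (- char_matrix K x) $$ (i, j)"
        using ij L K by (auto simp: M_def char_matrix_def K_def)
      finally show "(- char_matrix K x) $$ (i, j) = (M * W) $$ (i, j)" ..
    qed (use K M W in \<open>auto simp: char_matrix_def\<close>)
    then have "poly (char_poly K) x = det M * det W"
      using char_poly_matrix[OF K] det_mult[OF M W] by simp
    also have "det M = poly (char_poly L) x"
      using char_poly_matrix[OF L] by (simp add: M_def)
    also have "det W = (\<Prod>i\<in>{0..<n}. W $$ (i, i))"
      using W by (subst det_lower_triangular[OF _ W]) (auto simp: W_def prod_list_diag_prod)
    also have "\<dots> = (\<Prod>i\<in>{0..<n}. if i = 0 then 1 - 1 / x else 1)"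
      by (intro prod.cong) (auto simp: W_def)
    also have "\<dots> = 1 - 1 / x"
      using n by simp
    finally show ?thesis
      using False by (simp add: field_simps)
  qed
  then have "poly ([:0, 1:] * char_poly K) x = poly ([:- 1, 1:] * char_poly L) x" for x
    by (simp add: algebra_simps)
  then show ?thesis
    unfolding K_def by (simp only: poly_eq_poly_eq_iff[symmetric] fun_eq_iff) blast
qed

section \<open>Graph Laplacians, and coherence from a Green matrix\<close>

lemma out_degree_with_proj:
  "out_degree (with_proj G) v = card {w. (v, w) \<in> parcs G}"
proof -
  have "out_arcs (with_proj G) v = Pair v ` {w. (v, w) \<in> parcs G}"
    by (auto simp: out_arcs_def)
  then show ?thesis
    by (simp add: out_degree_def card_image inj_on_def)
qed

text \<open>Lets later arguments work with functions on vertices instead of the enumeration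
  \<open>vs\<close>.\<close>

lemma (in pair_graph) sum_laplacian_mat_mult:
  assumes vs: "distinct vs" "set vs = pverts G" and i: "i < length vs"
  shows "(\<Sum>j<length vs. laplacian_mat G vs $$ (i, j) * f (vs ! j))
    = (\<Sum>q | (vs ! i, q) \<in> parcs G. f (vs ! i) - f q)"
proof -
  let ?p = "vs ! i"
  have p: "?p \<in> pverts G" using nth_mem[OF i] vs(2) by simp
  have bij: "bij_betw ((!) vs) {..<length vs} (pverts G)"
    using vs by (simp add: bij_betw_nth)
  have fin: "finite (pverts G)" using vs(2) by (metis finite_set)
  have sub: "{q. (?p, q) \<in> parcs G} \<subseteq> pverts G"
    using in_arcsD2 by blast
  have entry: "laplacian_mat G vs $$ (i, j) =
      (if ?p = vs ! j then real (card {q. (?p, q) \<in> parcs G}) else 0)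
      - (if (?p, vs ! j) \<in> parcs G then 1 else 0)" if "j < length vs" for j
    using that i vs(1)
    by (auto simp: laplacian_mat_def degree_mat_def adjacency_mat_def out_degree_with_proj
        nth_eq_iff_index_eq)
  have "(\<Sum>j<length vs. laplacian_mat G vs $$ (i, j) * f (vs ! j)) =
     (\<Sum>j<length vs. ((if ?p = vs ! j then real (card {q. (?p, q) \<in> parcs G}) else 0)
       - (if (?p, vs ! j) \<in> parcs G then 1 else 0)) * f (vs ! j))"
    by (simp add: entry)
  also have "\<dots> = (\<Sum>q\<in>pverts G. ((if ?p = q then real (card {q. (?p, q) \<in> parcs G}) else 0)
       - (if (?p, q) \<in> parcs G then 1 else 0)) * f q)"
    by (rule sum.reindex_bij_betw[OF bij])
  also have "\<dots> = (\<Sum>q\<in>pverts G. (if ?p = q then real (card {q. (?p, q) \<in> parcs G}) * f q else 0)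
       - (if (?p, q) \<in> parcs G then f q else 0))"
    by (intro sum.cong) (auto simp: algebra_simps)
  also have "\<dots> = real (card {q. (?p, q) \<in> parcs G}) * f ?p
       - (\<Sum>q\<in>pverts G. if (?p, q) \<in> parcs G then f q else 0)"
    using p fin by (simp add: sum_subtractf)
  also have "(\<Sum>q\<in>pverts G. if (?p, q) \<in> parcs G then f q else 0)
      = (\<Sum>q | (?p, q) \<in> parcs G. f q)"
    using sub fin by (subst sum.inter_filter[symmetric]) (auto intro!: sum.cong)
  finally show ?thesis
    by (simp add: sum_subtractf)
qed

text \<open>Maximum principle: where an eigenvector has its largest absolute value, all differences
  to neighbours have the sign of that entry or vanish. This puts the eigenvalue 0 first in the
  sorted spectrum.\<close>

lemma (in pair_graph) laplacian_eigenvalue_nonneg: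
  assumes vs: "distinct vs" "set vs = pverts G"
    and root: "poly (char_poly (laplacian_mat G vs)) a = 0"
  shows "0 \<le> a"
proof -
  let ?n = "length vs" and ?L = "laplacian_mat G vs"
  have L: "?L \<in> carrier_mat ?n ?n"
    by (auto simp: laplacian_mat_def degree_mat_def adjacency_mat_def)
  obtain v where v: "v \<in> carrier_vec ?n" "v \<noteq> 0\<^sub>v ?n" "?L *\<^sub>v v = a \<cdot>\<^sub>v v"
    using root eigenvalue_root_char_poly[OF L] L by (auto simp: eigenvalue_def eigenvector_def)
  \<comment> \<open>\<open>f\<close> moves the eigenvector from indices to vertices.\<close>
  define f where "f = (\<lambda>q. v $ (THE j. j < ?n \<and> vs ! j = q))"
  have f: "f (vs ! j) = v $ j" if "j < ?n" for j
    unfolding f_def using that vs(1)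
    by (intro arg_cong[of _ _ "($) v"] the_equality) (auto simp: nth_eq_iff_index_eq)
  obtain j where j: "j < ?n" "v $ j \<noteq> 0"
    using v by (metis carrier_vecD eq_vecI index_zero_vec)
  have "Max ((\<lambda>i. \<bar>v $ i\<bar>) ` {..<?n}) \<in> (\<lambda>i. \<bar>v $ i\<bar>) ` {..<?n}"
    using j by (intro Max_in) auto
  then obtain i where i: "i < ?n" "\<bar>v $ i\<bar> = Max ((\<lambda>i. \<bar>v $ i\<bar>) ` {..<?n})"
    by auto
  have max: "\<bar>v $ l\<bar> \<le> \<bar>v $ i\<bar>" if "l < ?n" for l
    unfolding i(2) using that by (intro Max_ge) auto
  have bound: "\<bar>f q\<bar> \<le> \<bar>v $ i\<bar>" if "(vs ! i, q) \<in> parcs G" for q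
  proof -
    have "q \<in> set vs" using that vs(2) in_arcsD2 by blast
    then show ?thesis using f max by (metis in_set_conv_nth)
  qed
  have "a * v $ i = (?L *\<^sub>v v) $ i"
    using v i by simp
  also have "\<dots> = (\<Sum>j<?n. ?L $$ (i, j) * f (vs ! j))"
    using L v(1) i f by (simp add: scalar_prod_def lessThan_atLeast0)
  also have "\<dots> = (\<Sum>q | (vs ! i, q) \<in> parcs G. v $ i - f q)"
    using sum_laplacian_mat_mult[OF vs i(1), of f] f i(1) by simp
  finally have a: "a * v $ i = (\<Sum>q | (vs ! i, q) \<in> parcs G. v $ i - f q)" .
  have "v $ i \<noteq> 0" using max[OF j(1)] j(2) by auto
  then consider "0 < v $ i" | "v $ i < 0" by linarith
  then show "0 \<le> a"
  proof cases
    case 1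
    then have "0 \<le> a * v $ i"
      unfolding a using bound by (intro sum_nonneg) fastforce
    with 1 show ?thesis by (simp add: zero_le_mult_iff)
  next
    case 2
    then have "a * v $ i \<le> 0"
      unfolding a using bound by (intro sum_nonpos) fastforce
    with 2 show ?thesis by (simp add: mult_le_0_iff)
  qed
qed

lemma (in pair_graph) network_coherence_Green:
  assumes ne: "pverts G \<noteq> {}"
    and green: "\<And>p r. p \<in> pverts G \<Longrightarrow> r \<in> pverts G \<Longrightarrow>
      (\<Sum>q | (p, q) \<in> parcs G. g p r - g q r) = (if p = r then 1 else 0) - 1 / card (pverts G)"
    and rows: "\<And>p. p \<in> pverts G \<Longrightarrow> (\<Sum>r\<in>pverts G. g p r) = c"
  shows "network_coherence G = ((\<Sum>p\<in>pverts G. g p p) - c) / (2 * real (card (pverts G)))"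
proof -
  define vs where "vs = vertex_enum G"
  have vs: "distinct vs" "set vs = pverts G"
    unfolding vs_def using vertex_enum[OF pair_finite_verts] by simp_all
  define n where "n = length vs"
  have n: "card (pverts G) = n"
    using vs by (metis distinct_card n_def)
  have n0: "0 < n" using ne vs by (auto simp: n_def)
  have bij: "bij_betw ((!) vs) {..<n} (pverts G)"
    using vs by (simp add: bij_betw_nth n_def)
  have vs_in: "vs ! i \<in> pverts G" if "i < n" for i
    using that vs(2) nth_mem[of i vs] by (simp add: n_def)
  define L where "L = laplacian_mat G vs"
  have L: "L \<in> carrier_mat n n"
    by (auto simp: L_def n_def laplacian_mat_def degree_mat_def adjacency_mat_def)
  note mult = sum_laplacian_mat_mult[OF vs, folded n_def L_def]
  have Lrow: "(\<Sum>j<n. L $$ (i, j)) = 0" if "i < n" for i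
    using mult[OF that, of "\<lambda>_. 1"] by simp
  have sym: "L $$ (i, j) = L $$ (j, i)" if "i < n" "j < n" for i j
  proof -
    have "(vs ! i, vs ! j) \<in> parcs G \<longleftrightarrow> (vs ! j, vs ! i) \<in> parcs G"
      using arcs_symmetric by blast
    then show ?thesis
      using that by (auto simp: L_def n_def laplacian_mat_def degree_mat_def adjacency_mat_def)
  qed
  obtain as where as: "char_poly L = (\<Prod>a\<leftarrow>as. [:- a, 1:])"
    using symmetric_real_mat_char_poly_factorized[OF L sym] by blast
  have as_nonneg: "0 \<le> a" if "a \<in> set as" for a
    using laplacian_eigenvalue_nonneg[OF vs, folded L_def] that
    by (auto simp: as poly_prod_list prod_list_zero_iff)
  define K where "K = L + mat n n (\<lambda>(i, j). if j = 0 then 1 else 0)"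
  have K: "K \<in> carrier_mat n n" using L by (simp add: K_def)
  have char_K: "[:0, 1:] * char_poly K = [:- 1, 1:] * char_poly L"
    unfolding K_def by (rule char_poly_add_ones_column[OF L n0 Lrow])
  \<comment> \<open>At 0 the left side vanishes and \<open>[:- 1, 1:]\<close> does not, so 0 is a
    root of \<open>char_poly L\<close>.\<close>
  from arg_cong[OF this, of "\<lambda>p. poly p 0"] have "0 \<in> set as"
    by (auto simp: as poly_prod_list prod_list_zero_iff)
  define bs where "bs = remove1 0 as"
  have mset_as: "mset as = mset (0 # bs)"
    using \<open>0 \<in> set as\<close> by (simp add: bs_def)
  have as_bs: "(\<Prod>a\<leftarrow>as. [:- a, 1:]) = [:0, 1:] * (\<Prod>a\<leftarrow>bs. [:- a, 1:])"
  proof -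
    have "(\<Prod>a\<leftarrow>as. [:- a, 1:]) = prod_mset (image_mset (\<lambda>a. [:- a, 1:]) (mset as))"
      by (metis mset_map prod_mset_prod_list)
    also have "\<dots> = [:- 0, 1:] * prod_mset (image_mset (\<lambda>a. [:- a, 1:]) (mset bs))"
      unfolding mset_as by simp
    also have "prod_mset (image_mset (\<lambda>a. [:- a, 1:]) (mset bs)) = (\<Prod>a\<leftarrow>bs. [:- a, 1:])"
      by (metis mset_map prod_mset_prod_list)
    finally show ?thesis by simp
  qed
  have "[:0, 1:] * char_poly K = [:0, 1:] * ([:- 1, 1:] * (\<Prod>a\<leftarrow>bs. [:- a, 1:]))"
    using char_K unfolding as as_bs by (simp only: mult.left_commute)
  then have char_K': "char_poly K = (\<Prod>a\<leftarrow>1 # bs. [:- a, 1:])"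
    unfolding mult_cancel_left by simp
  \<comment> \<open>Each column of \<open>g\<close> is shifted by a constant, which \<open>L\<close>
    annihilates. The shift makes row 0 equal to \<open>1 / n\<close>; the ones column of
    \<open>K\<close> spreads this value to every row and so cancels the defect
    \<open>- 1 / n\<close> of the Green equation.\<close>
  define X where "X = mat n n (\<lambda>(i, j). g (vs ! i) (vs ! j) + 1 / n - g (vs ! 0) (vs ! j))"
  have X: "X \<in> carrier_mat n n" by (simp add: X_def)
  have "K * X = 1\<^sub>m n"
  proof (rule eq_matI)
    fix i j assume "i < dim_row (1\<^sub>m n)" "j < dim_col (1\<^sub>m n)"
    then have ij: "i < n" "j < n" by auto
    define h where "h = (\<lambda>p. g p (vs ! j) + 1 / n - g (vs ! 0) (vs ! j))"
    have "(K * X) $$ (i, j) = (\<Sum>l<n. (L $$ (i, l) + (if l = 0 then 1 else 0)) * h (vs ! l))"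
      using ij L K X by (simp add: scalar_prod_def K_def X_def h_def lessThan_atLeast0)
    also have "\<dots> = (\<Sum>l<n. L $$ (i, l) * h (vs ! l) + (if l = 0 then h (vs ! l) else 0))"
      by (intro sum.cong) (auto simp: algebra_simps)
    also have "\<dots> = (\<Sum>l<n. L $$ (i, l) * h (vs ! l)) + 1 / n"
      using n0 by (simp add: sum.distrib h_def)
    also have "(\<Sum>l<n. L $$ (i, l) * h (vs ! l)) = (if vs ! i = vs ! j then 1 else 0) - 1 / n"
      unfolding mult[OF ij(1)] using green[OF vs_in[OF ij(1)] vs_in[OF ij(2)]]
      by (simp add: h_def n)
    finally show "(K * X) $$ (i, j) = 1\<^sub>m n $$ (i, j)"
      using ij vs(1) by (auto simp: n_def nth_eq_iff_index_eq)
  qed (use K X in auto)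
  note trace = sum_diag_inverse_eq_sum_inverse_eigenvalues[OF K X this char_K']
  \<comment> \<open>The summand 1 here is matched by the eigenvalue 1 of \<open>K\<close>, leaving
    the sum over \<open>bs\<close>.\<close>
  have "(\<Sum>i<n. X $$ (i, i)) = (\<Sum>i<n. g (vs ! i) (vs ! i)) + 1 - (\<Sum>i<n. g (vs ! 0) (vs ! i))"
    using n0 by (simp add: X_def sum.distrib sum_subtractf)
  also have "(\<Sum>i<n. g (vs ! i) (vs ! i)) = (\<Sum>p\<in>pverts G. g p p)"
    by (rule sum.reindex_bij_betw[OF bij])
  also have "(\<Sum>i<n. g (vs ! 0) (vs ! i)) = (\<Sum>r\<in>pverts G. g (vs ! 0) r)"
    by (rule sum.reindex_bij_betw[OF bij])
  finally have sum_bs: "(\<Sum>b\<leftarrow>bs. 1 / b) = (\<Sum>p\<in>pverts G. g p p) - c"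
    using trace(1) rows[OF vs_in[OF n0]] by simp
  have len: "n = Suc (length bs)"
    using degree_monic_char_poly[OF L] degree_linear_factors[of uminus as] mset_as
    by (metis as length_Cons mset_eq_length)
  have "proots (\<Prod>x\<leftarrow>xs. [:- x, 1:]) = mset xs" for xs :: "real list"
  proof (induction xs)
    case (Cons x xs)
    have "(\<Prod>x\<leftarrow>xs. [:- x, 1:]) \<noteq> 0"
      by (auto simp: prod_list_zero_iff)
    then have "proots ([:- x, 1:] * (\<Prod>x\<leftarrow>xs. [:- x, 1:])) = {#x#} + mset xs"
      by (subst proots_mult) (use Cons in auto)
    then show ?case by (simp del: mult_pCons_left)
  qed simp
  then have "proots (char_poly L) = mset as"
    by (simp only: as)
  then have "laplacian_spectrum G = sort as"
    unfolding laplacian_spectrum_def vs_def[symmetric] L_def[symmetric]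
    by (simp only: sorted_list_of_multiset_mset)
  also have "set bs \<subseteq> set as"
    unfolding bs_def by (rule set_remove1_subset)
  then have "sort as = 0 # sort bs"
    using as_nonneg mset_as by (intro properties_for_sort) (simp_all add: subset_iff)
  finally have "laplacian_spectrum G = 0 # sort bs" .
  then have "(\<Sum>i=2..n. 1 / laplacian_eigenvalue G i) = (\<Sum>i=2..n. 1 / (0 # sort bs) ! (i - 1))"
    by (simp add: laplacian_eigenvalue_def)
  \<comment> \<open>\<open>laplacian_eigenvalue\<close> counts from 1 and the leading 0 is skipped,
    hence the shift by 2.\<close>
  also have "\<dots> = (\<Sum>i<length (sort bs). 1 / sort bs ! i)"
    unfolding len
    by (rule sum.reindex_bij_witness[of _ "\<lambda>i. i + 2" "\<lambda>i. i - 2"]) (auto simp: nth_Cons' eval_nat_numeral)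
  also have "\<dots> = (\<Sum>b\<leftarrow>sort bs. 1 / b)"
    by (simp add: sum_list_sum_nth lessThan_atLeast0)
  also have "\<dots> = (\<Sum>b\<leftarrow>bs. 1 / b)"
    by (metis mset_map mset_sort sum_mset_sum_list)
  finally show ?thesis
    unfolding network_coherence_def n sum_bs by simp
qed

section \<open>The bridge involution and adjacency of words\<close>

text \<open>
  The involution \<open>w x y\<^sup>m \<mapsto> w y x\<^sup>m\<close> (for \<open>x \<noteq> y\<close>, \<open>m \<ge> 1\<close>)
  that exchanges the endpoints of every edge joining two different \<open>k\<close>-cliques
  \<open>{wa | a}\<close>; it fixes exactly the extreme vertices \<open>x\<^sup>n\<close>.
\<close>

fun bridge :: "'a list \<Rightarrow> 'a list" where
  "bridge [] = []"
| "bridge (x # ys) =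
    (if set ys = {hd ys} \<and> hd ys \<noteq> x then hd ys # map (\<lambda>_. x) ys else x # bridge ys)"

lemma length_bridge [simp]: "length (bridge p) = length p"
  by (induction p) auto

lemma set_bridge [simp]: "set (bridge p) = set p"
  by (induction p) auto

lemma bridge_eq_Nil_iff [simp]: "bridge p = [] \<longleftrightarrow> p = []"
  by (metis length_0_conv length_bridge)

lemma bridge_eq_self_iff: "bridge p = p \<longleftrightarrow> (\<forall>x\<in>set p. x = hd p)"
proof (induction p)
  case (Cons x ys)
  show ?case
  proof (cases ys)
    case (Cons y zs)
    then show ?thesis using Cons.IH by auto
  qed simp
qed simp

text \<open>The second application takes the same branch as the first: a swap leaves a constant
  tail, and otherwise the tail keeps its set of letters.\<close>

lemma bridge_bridge [simp]: "bridge (bridge p) = p"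
proof (induction p)
  case (Cons x ys)
  show ?case
  proof (cases "set ys = {hd ys} \<and> hd ys \<noteq> x")
    case True
    then have ne: "ys \<noteq> []" by auto
    have "map (\<lambda>_. hd ys) ys = ys"
      using True by (intro map_idI) auto
    then show ?thesis
      using True ne by (auto simp: hd_map o_def)
  next
    case False
    have "\<not> (set (bridge ys) = {hd (bridge ys)} \<and> hd (bridge ys) \<noteq> x)"
    proof
      assume *: "set (bridge ys) = {hd (bridge ys)} \<and> hd (bridge ys) \<noteq> x"
      then have "ys \<noteq> []" by auto
      then have "hd ys \<in> set ys" by simp
      then show False using * False by auto
    qed
    then show ?thesis using False Cons.IH by auto
  qed
qed simp

text \<open>While two distinct letters remain in the tail it is not constant, so the recursion runs
  down to the last two letters.\<close>

lemma bridge_snoc_neq: "a \<noteq> y \<Longrightarrow> bridge (p @ [y, a]) = p @ [a, y]"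
proof (induction p)
  case (Cons x p)
  have "y \<in> set (p @ [y, a])" "a \<in> set (p @ [y, a])" by simp_all
  with Cons.prems have "\<not> set (p @ [y, a]) = {hd (p @ [y, a])}"
    by (metis singletonD)
  then show ?case
    using Cons by (simp only: append_Cons bridge.simps simp_thms if_False)
qed auto

lemma butlast_bridge_snoc_eq: "butlast (bridge (p @ [y, y])) = bridge (p @ [y])"
proof (induction p)
  case (Cons x p)
  have "hd (p @ [y, y]) = hd (p @ [y])" by (cases p) auto
  then show ?case using Cons by (auto simp: butlast_append)
qed simp

text \<open>A proper bridge leaves the clique, so it is never counted among the clique
  edges.\<close>

lemma butlast_bridge_neq: "bridge p \<noteq> p \<Longrightarrow> butlast (bridge p) \<noteq> butlast p"
  by (induction p) (auto split: if_splits)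

lemma sierpinski_adj_Cons:
  assumes "length p = n" "length q = n"
  shows "sierpinski_adj (Suc n) (x # p) (y # q) \<longleftrightarrow>
    (if x = y then sierpinski_adj n p q else set p \<subseteq> {y} \<and> set q \<subseteq> {x})"
proof (cases "x = y")
  case True
  have shift: "(\<forall>i. Suc h < i \<and> i < Suc n \<longrightarrow> P i) \<longleftrightarrow> (\<forall>i. h < i \<and> i < n \<longrightarrow> P (Suc i))" for h P
    by (auto simp: Suc_less_eq2)
  show ?thesis
    unfolding sierpinski_adj_def using True by (simp add: Ex_less_Suc2 All_less_Suc2 shift)
next
  case False
  have "sierpinski_adj (Suc n) (x # p) (y # q) \<longleftrightarrow> (\<forall>i<n. p ! i = y \<and> q ! i = x)"
    unfolding sierpinski_adj_def using False by (auto simp: less_Suc_eq_0_disj)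
  also have "\<dots> \<longleftrightarrow> set p \<subseteq> {y} \<and> set q \<subseteq> {x}"
    using assms by (auto simp: set_conv_nth)
  finally show ?thesis using False by simp
qed

text \<open>Induction from the front: equal first letters pass to the tails, while distinct ones
  \<open>x\<close> and \<open>y\<close> force the words \<open>x y ... y\<close> and
  \<open>y x ... x\<close>, which \<open>bridge\<close> exchanges.\<close>

lemma sierpinski_adj_iff:
  assumes "length p = Suc n" "length q = Suc n"
  shows "sierpinski_adj (Suc n) p q \<longleftrightarrow> p \<noteq> q \<and> (butlast p = butlast q \<or> q = bridge p)"
  using assms
proof (induction n arbitrary: p q)
  case 0
  then show ?case
    by (auto simp: sierpinski_adj_def length_Suc_conv)
next
  case (Suc n)
  obtain x ys where p: "p = x # ys" "length ys = Suc n" using Suc.prems by (auto simp: length_Suc_conv)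
  obtain y zs where q: "q = y # zs" "length zs = Suc n" using Suc.prems by (auto simp: length_Suc_conv)
  have ne: "ys \<noteq> []" "zs \<noteq> []" using p q by auto
  note adj = sierpinski_adj_Cons[OF p(2) q(2), of x y]
  show ?case
  proof (cases "x = y")
    case True
    \<comment> \<open>If \<open>bridge\<close> swaps at the first letter, the tail is constant and
      hence fixed by \<open>bridge\<close>, so the tails are not joined by a bridge edge
      either.\<close>
    have "bridge ys = ys" if "set ys = {hd ys}"
      using that by (simp add: bridge_eq_self_iff)
    then show ?thesis
      using True adj Suc.IH[OF p(2) q(2)] ne by (auto simp: p q)
  next
    case False
    have "set ys \<subseteq> {y} \<and> set zs \<subseteq> {x} \<longleftrightarrow> set ys = {hd ys} \<and> hd ys = y \<and> zs = map (\<lambda>_. x) ys"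
    proof (intro iffI conjI)
      assume *: "set ys \<subseteq> {y} \<and> set zs \<subseteq> {x}"
      show "hd ys = y" using * ne hd_in_set[of ys] by blast
      then show "set ys = {hd ys}" using * ne by (metis set_empty subset_singleton_iff)
      show "zs = map (\<lambda>_. x) ys"
        using * p(2) q(2) by (intro nth_equalityI) (auto simp: subset_iff)
    qed auto
    then show ?thesis
      using False adj ne by (auto simp: p q)
  qed
qed

section \<open>Vertex sets and the Laplacian of Sierpinski graphs\<close>

lemma finite_sierpinski_vertices [simp]: "finite (sierpinski_vertices n k)"
  by (simp add: sierpinski_vertices_def finite_lists_length_eq)

lemma card_sierpinski_vertices: "card (sierpinski_vertices n k) = k ^ n"
  by (simp add: sierpinski_vertices_def card_lists_length_eq)

lemma sierpinski_vertices_0 [simp]: "sierpinski_vertices 0 k = {[]}"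
  by (auto simp: sierpinski_vertices_def)

lemma snoc_in_sierpinski_vertices [simp]:
  "p @ [a] \<in> sierpinski_vertices (Suc n) k \<longleftrightarrow> p \<in> sierpinski_vertices n k \<and> a \<in> {1..k}"
  by (auto simp: sierpinski_vertices_def)

lemma bridge_in_sierpinski_vertices [simp]:
  "bridge p \<in> sierpinski_vertices n k \<longleftrightarrow> p \<in> sierpinski_vertices n k"
  by (auto simp: sierpinski_vertices_def)

lemma sierpinski_vertices_SucE:
  assumes "p \<in> sierpinski_vertices (Suc n) k"
  obtains b a where "p = b @ [a]" "b \<in> sierpinski_vertices n k" "a \<in> {1..k}"
  using assms by (cases p rule: rev_cases) (auto simp: sierpinski_vertices_def)

lemma butlast_in_sierpinski_vertices:
  "p \<in> sierpinski_vertices (Suc n) k \<Longrightarrow> butlast p \<in> sierpinski_vertices n k"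
  by (erule sierpinski_vertices_SucE) simp

lemma sum_sierpinski_vertices_Suc:
  "sum f (sierpinski_vertices (Suc n) k) = (\<Sum>p\<in>sierpinski_vertices n k. \<Sum>a=1..k. f (p @ [a]))"
proof -
  have "(\<Sum>p\<in>sierpinski_vertices n k. \<Sum>a=1..k. f (p @ [a])) =
      (\<Sum>(p, a)\<in>sierpinski_vertices n k \<times> {1..k}. f (p @ [a]))"
    by (simp add: sum.cartesian_product)
  also have "\<dots> = sum f (sierpinski_vertices (Suc n) k)"
    by (rule sum.reindex_bij_witness[of _ "\<lambda>p. (butlast p, last p)" "\<lambda>(p, a). p @ [a]"])
      (auto elim: sierpinski_vertices_SucE)
  finally show ?thesis ..
qed

lemma sum_sierpinski_vertices_bridge:
  "(\<Sum>p\<in>sierpinski_vertices n k. f (bridge p)) = sum f (sierpinski_vertices n k)"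
  by (rule sum.reindex_bij_witness[of _ bridge bridge]) auto

text \<open>
  An extreme vertex gets a loop from \<open>bridge\<close>, which does not affect the Laplacian.
  The empty word is the vertex of the one-point graph \<open>S(0,k)\<close>.
\<close>

definition sierpinski_laplacian :: "nat \<Rightarrow> (nat list \<Rightarrow> real) \<Rightarrow> nat list \<Rightarrow> real" where
  "sierpinski_laplacian k f p = (if p = [] then 0
     else (\<Sum>a=1..k. f p - f (butlast p @ [a])) + (f p - f (bridge p)))"

text \<open>The neighbours are the rest of the clique and the bridge partner; adding
  \<open>p\<close> itself contributes a zero difference.\<close>

lemma sum_neighbours_sierpinski:
  assumes p: "p \<in> sierpinski_vertices (Suc n) k"
  shows "(\<Sum>q | (p, q) \<in> parcs (sierpinski (Suc n) k). f p - f q) = sierpinski_laplacian k f p"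
proof -
  let ?C = "(\<lambda>a. butlast p @ [a]) ` {1..k}"
  have len: "length p = Suc n" "p \<noteq> []" using p by (auto simp: sierpinski_vertices_def)
  have "{q. (p, q) \<in> parcs (sierpinski (Suc n) k)} = (?C - {p}) \<union> ({bridge p} - {p})"
  proof (intro equalityI subsetI)
    fix q assume "q \<in> {q. (p, q) \<in> parcs (sierpinski (Suc n) k)}"
    then have q: "q \<in> sierpinski_vertices (Suc n) k" "sierpinski_adj (Suc n) p q"
      by (auto simp: sierpinski_def)
    then have "length q = Suc n" by (auto simp: sierpinski_vertices_def)
    then have "p \<noteq> q \<and> (butlast p = butlast q \<or> q = bridge p)"
      using q(2) len sierpinski_adj_iff by blast
    with q(1) show "q \<in> (?C - {p}) \<union> ({bridge p} - {p})"
      by (auto elim!: sierpinski_vertices_SucE)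
  next
    fix q assume q: "q \<in> (?C - {p}) \<union> ({bridge p} - {p})"
    then have "q \<in> sierpinski_vertices (Suc n) k"
      using p butlast_in_sierpinski_vertices[OF p] by auto
    moreover have "p \<noteq> q \<and> (butlast p = butlast q \<or> q = bridge p)"
      using q by auto
    ultimately show "q \<in> {q. (p, q) \<in> parcs (sierpinski (Suc n) k)}"
      using p len sierpinski_adj_iff[of p n q] by (auto simp: sierpinski_def sierpinski_vertices_def)
  qed
  moreover have "(?C - {p}) \<inter> ({bridge p} - {p}) = {}"
    using butlast_bridge_neq[of p] by (auto; metis butlast_snoc)
  ultimately have "(\<Sum>q | (p, q) \<in> parcs (sierpinski (Suc n) k). f p - f q)
      = (\<Sum>q\<in>?C - {p}. f p - f q) + (\<Sum>q\<in>{bridge p} - {p}. f p - f q)"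
    by (simp add: sum.union_disjoint)
  also have "(\<Sum>q\<in>?C - {p}. f p - f q) = (\<Sum>q\<in>?C. f p - f q)"
    by (intro sum.mono_neutral_left) auto
  also have "\<dots> = (\<Sum>a=1..k. f p - f (butlast p @ [a]))"
    by (subst sum.reindex) (auto simp: inj_on_def)
  also have "(\<Sum>q\<in>{bridge p} - {p}. f p - f q) = (\<Sum>q\<in>{bridge p}. f p - f q)"
    by (intro sum.mono_neutral_left) auto
  finally show ?thesis
    using len by (simp add: sierpinski_laplacian_def)
qed

text \<open>
  Contracting the cliques of \<open>S(n+1,k)\<close> yields \<open>S(n,k)\<close>: the edges leaving the
  clique of \<open>p\<close> are the edges of \<open>p\<close>.
\<close>

lemma sierpinski_laplacian_contract:
  assumes p: "p \<in> sierpinski_vertices n k"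
  shows "(\<Sum>a=1..k. f p - f (butlast (bridge (p @ [a])))) = sierpinski_laplacian k f p"
proof (cases n)
  case 0
  then show ?thesis using p by (simp add: sierpinski_laplacian_def)
next
  case (Suc m)
  then obtain b y where py: "p = b @ [y]" "y \<in> {1..k}"
    using p sierpinski_vertices_SucE by blast
  \<comment> \<open>Extending \<open>p\<close> by \<open>a\<close> different from \<open>y\<close>
    leads over to the clique mate \<open>b @ [a]\<close>; repeating \<open>y\<close> leads to the
    bridge partner of \<open>p\<close>.\<close>
  have *: "f (butlast (bridge (p @ [a]))) = (if a = y then f (bridge p) else f (b @ [a]))" for a
    using bridge_snoc_neq[of a y b] butlast_bridge_snoc_eq[of b y] by (auto simp: py butlast_append)
  have "(\<Sum>a=1..k. f p - f (butlast (bridge (p @ [a]))))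
      = (\<Sum>a=1..k. (f p - f (b @ [a])) + (if a = y then f p - f (bridge p) else 0))"
    unfolding * by (intro sum.cong) (auto simp: py)
  also have "\<dots> = sierpinski_laplacian k f p"
    using py by (simp add: sum.distrib sierpinski_laplacian_def)
  finally show ?thesis .
qed

section \<open>Green matrices of Sierpinski graphs\<close>

text \<open>
  With \<open>E\<close> the incidence matrix of words of length \<open>n+1\<close> with their prefixes and \<open>S\<close>
  the permutation matrix of \<open>bridge\<close>, the Laplacian is \<open>L\<^sub>n\<^sub>+\<^sub>1 = R\<^sup>-\<^sup>1 - E E\<^sup>T\<close> where
  \<open>R = (k + 1 + S) / (k (k + 2))\<close>, and \<open>E\<^sup>T R E = I - L\<^sub>n / (k (k + 2))\<close>. The recursion below is
  the resulting Woodbury formula \<open>G\<^sub>n\<^sub>+\<^sub>1 = R + k (k + 2) R E G\<^sub>n E\<^sup>T R\<close>.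
\<close>

fun sierpinski_Green :: "nat \<Rightarrow> nat \<Rightarrow> nat list \<Rightarrow> nat list \<Rightarrow> real" where
  "sierpinski_Green k 0 p q = 0"
| "sierpinski_Green k (Suc n) p q =
    ((real k + 1) * of_bool (p = q) + of_bool (bridge p = q)
     + (real k + 1) * ((real k + 1) * sierpinski_Green k n (butlast p) (butlast q)
                       + sierpinski_Green k n (butlast p) (butlast (bridge q)))
     + ((real k + 1) * sierpinski_Green k n (butlast (bridge p)) (butlast q)
        + sierpinski_Green k n (butlast (bridge p)) (butlast (bridge q))))
    / (real k * (real k + 2))"

lemma sum_of_bool_snoc:
  assumes q: "q \<in> sierpinski_vertices (Suc n) k"
  shows "(\<Sum>a=1..k. of_bool (b @ [a] = q)) = (of_bool (b = butlast q) :: real)"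
proof -
  obtain c a where c: "q = c @ [a]" "a \<in> {1..k}"
    using q by (rule sierpinski_vertices_SucE)
  have "(\<Sum>x=1..k. of_bool (b @ [x] = q)) = (\<Sum>x=1..k. if x = a then of_bool (b = c) else (0 :: real))"
    using c by (intro sum.cong) auto
  also have "\<dots> = of_bool (b = butlast q)"
    using c by simp
  finally show ?thesis .
qed

text \<open>Induction along the Woodbury recursion: summing over a clique contracts the
  \<open>h\<close> terms to the Laplacian one level down, where the induction hypothesis
  applies.\<close>

lemma sierpinski_laplacian_Green:
  assumes "1 \<le> k" "p \<in> sierpinski_vertices n k" "q \<in> sierpinski_vertices n k"
  shows "sierpinski_laplacian k (\<lambda>p. sierpinski_Green k n p q) p = of_bool (p = q) - 1 / real k ^ n"
  using assms(2,3)
proof (induction n arbitrary: p q)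
  case 0
  then show ?case by (simp add: sierpinski_laplacian_def)
next
  case (Suc n)
  define K where "K = real k"
  have K: "K > 0" using assms(1) by (simp add: K_def)
  obtain b y where p: "p = b @ [y]" "b \<in> sierpinski_vertices n k" "y \<in> {1..k}"
    using Suc.prems(1) by (rule sierpinski_vertices_SucE)
  let ?b' = "butlast (bridge p)"
  have q: "butlast q \<in> sierpinski_vertices n k" "butlast (bridge q) \<in> sierpinski_vertices n k"
    using Suc.prems(2) by (auto intro!: butlast_in_sierpinski_vertices)
  define h where "h = (\<lambda>p. (K + 1) * sierpinski_Green k n p (butlast q)
    + sierpinski_Green k n p (butlast (bridge q)))"
  define D where "D = (\<lambda>p. (K + 1) * of_bool (p = q) + of_bool (bridge p = q))"
  define F where "F = (\<lambda>p. D p + (K + 1) * h (butlast p) + h (butlast (bridge p)))"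
  have green: "sierpinski_Green k (Suc n) r q = F r / (K * (K + 2))" for r
    by (simp add: F_def D_def h_def K_def)
  have linear: "sierpinski_laplacian k (\<lambda>r. F r / c) p = sierpinski_laplacian k F p / c" for c
    by (simp add: sierpinski_laplacian_def sum_divide_distrib add_divide_distrib diff_divide_distrib)
  have IH: "sierpinski_laplacian k h b = (K + 1) * (of_bool (b = butlast q) - 1 / K ^ n)
      + (of_bool (b = butlast (bridge q)) - 1 / K ^ n)"
  proof -
    have "sierpinski_laplacian k h b =
        (K + 1) * sierpinski_laplacian k (\<lambda>p. sierpinski_Green k n p (butlast q)) b
        + sierpinski_laplacian k (\<lambda>p. sierpinski_Green k n p (butlast (bridge q))) b"
      by (simp add: sierpinski_laplacian_def h_def sum.distrib sum_subtractf sum_distrib_left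
          algebra_simps)
    then show ?thesis
      using Suc.IH[OF p(2)] q by (simp add: K_def)
  qed
  have sum_D: "(\<Sum>a=1..k. D (b @ [a])) = (K + 1) * of_bool (b = butlast q) + of_bool (b = butlast (bridge q))"
  proof -
    have eq: "bridge (b @ [a]) = q \<longleftrightarrow> b @ [a] = bridge q" for a
      by (metis bridge_bridge)
    have "bridge q \<in> sierpinski_vertices (Suc n) k" using Suc.prems(2) by simp
    from sum_of_bool_snoc[OF this, of b] sum_of_bool_snoc[OF Suc.prems(2), of b]
    show ?thesis
      by (simp add: D_def eq sum.distrib flip: sum_distrib_left)
  qed
  \<comment> \<open>Clique mates share the prefix \<open>b\<close>, so the terms
    \<open>(K + 1) * h b\<close> drop out; inserting \<open>h b\<close> prepares the
    contraction.\<close>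
  have "(\<Sum>a=1..k. F p - F (b @ [a])) = (\<Sum>a=1..k. D p - D (b @ [a]) + (h ?b' - h b)
       + (h b - h (butlast (bridge (b @ [a])))))"
    by (intro sum.cong) (simp_all add: F_def p)
  also have "\<dots> = K * D p - (\<Sum>a=1..k. D (b @ [a])) + K * (h ?b' - h b) + sierpinski_laplacian k h b"
    using sierpinski_laplacian_contract[OF p(2), of h]
    by (simp add: sum.distrib sum_subtractf K_def algebra_simps)
  finally have "sierpinski_laplacian k F p
      = K * D p - (\<Sum>a=1..k. D (b @ [a])) + K * (h ?b' - h b) + sierpinski_laplacian k h b + (F p - F (bridge p))"
    by (simp add: sierpinski_laplacian_def p)
  \<comment> \<open>\<open>bridge\<close> exchanges the two \<open>h\<close> terms, and what remains
    cancels the multiple of \<open>h ?b' - h b\<close> from the clique part.\<close>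
  also have "F p - F (bridge p) = K * of_bool (p = q) - K * of_bool (bridge p = q) + K * (h b - h ?b')"
    by (simp add: F_def D_def p algebra_simps)
  finally have F: "sierpinski_laplacian k F p = K * (K + 2) * of_bool (p = q) - (K + 2) / K ^ n"
    unfolding sum_D IH by (simp add: D_def algebra_simps add_divide_distrib)
  show ?case
    unfolding green linear F K_def[symmetric] using K by (simp add: diff_divide_distrib)
qed

text \<open>Each prefix has \<open>k\<close> extensions and \<open>bridge\<close> permutes the
  words, so the row sums satisfy \<open>c' = (k + 2) * c + 1 / k\<close>, starting from 0.\<close>

lemma sum_sierpinski_Green_row:
  assumes "1 \<le> k" "p \<in> sierpinski_vertices n k"
  shows "(\<Sum>q\<in>sierpinski_vertices n k. sierpinski_Green k n p q)
    = ((real k + 2) ^ n - 1) / (real k * (real k + 1))"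
  using assms(2)
proof (induction n arbitrary: p)
  case (Suc n)
  define c where "c = ((real k + 2) ^ n - 1) / (real k * (real k + 1))"
  have k: "real k > 0" using assms(1) by simp
  let ?V = "sierpinski_vertices (Suc n) k"
  have row: "(\<Sum>q\<in>?V. sierpinski_Green k n r (butlast q)) = real k * c"
    if "r \<in> sierpinski_vertices n k" for r
    using Suc.IH[OF that] by (simp add: sum_sierpinski_vertices_Suc c_def flip: sum_distrib_left)
  have row': "(\<Sum>q\<in>?V. sierpinski_Green k n r (butlast (bridge q))) = real k * c"
    if "r \<in> sierpinski_vertices n k" for r
    using row[OF that] by (subst sum_sierpinski_vertices_bridge)
  have p: "butlast p \<in> sierpinski_vertices n k" "butlast (bridge p) \<in> sierpinski_vertices n k"
    using Suc.prems by (auto intro!: butlast_in_sierpinski_vertices)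
  have delta: "(\<Sum>q\<in>?V. of_bool (r = q)) = (1 :: real)" if "r \<in> ?V" for r
    using that by (simp add: of_bool_def)
  have "bridge p \<in> ?V" using Suc.prems by simp
  then have "(\<Sum>q\<in>?V. sierpinski_Green k (Suc n) p q)
      = ((real k + 2) + (real k + 2)\<^sup>2 * (real k * c)) / (real k * (real k + 2))"
    using delta Suc.prems
    by (simp add: sum.distrib row[OF p(1)] row[OF p(2)] row'[OF p(1)] row'[OF p(2)] power2_eq_square
        algebra_simps flip: sum_divide_distrib sum_distrib_left)
  also have "\<dots> = ((real k + 2) ^ Suc n - 1) / (real k * (real k + 1))"
    using k by (simp add: c_def divide_simps) (simp add: power2_eq_square algebra_simps)
  finally show ?case .
qed simp

section \<open>The trace of the Green matrix\<close>

lemma card_bridge_fixed: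
  "card {p \<in> sierpinski_vertices (Suc n) k. bridge p = p} = k"
proof -
  have "{p \<in> sierpinski_vertices (Suc n) k. bridge p = p} = (\<lambda>x. replicate (Suc n) x) ` {1..k}"
  proof (intro equalityI subsetI)
    fix p assume "p \<in> {p \<in> sierpinski_vertices (Suc n) k. bridge p = p}"
    then have p: "length p = Suc n" "set p \<subseteq> {1..k}" "\<forall>x\<in>set p. x = hd p"
      by (auto simp: sierpinski_vertices_def bridge_eq_self_iff)
    then have "p = replicate (Suc n) (hd p)"
      by (metis replicate_eqI)
    moreover have "hd p \<in> {1..k}"
      using p by (metis hd_in_set length_0_conv nat.distinct(1) subsetD)
    ultimately show "p \<in> (\<lambda>x. replicate (Suc n) x) ` {1..k}" by blast
  qed (auto simp: sierpinski_vertices_def bridge_eq_self_iff simp del: bridge.simps)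
  then show ?thesis
    by (simp add: card_image inj_on_def)
qed

text \<open>In the recursion on the diagonal, the pure terms reproduce the trace, the indicator of
  \<open>bridge\<close> counts the \<open>k\<close> extreme vertices, and the mixed terms follow
  from contraction and the Green equation.\<close>

lemma sum_sierpinski_Green_diag_Suc:
  assumes "1 \<le> k"
  defines "t \<equiv> \<lambda>n. \<Sum>p\<in>sierpinski_vertices n k. sierpinski_Green k n p p"
  shows "t (Suc n) = (real k + 2) * t n
    + ((real k + 1) * real k ^ Suc n + real k - 2 * (real k + 1) * (real k ^ n - 1))
      / (real k * (real k + 2))"
proof -
  have k: "real k > 0" using assms(1) by simp
  let ?V = "sierpinski_vertices n k" and ?V' = "sierpinski_vertices (Suc n) k"
  let ?g = "sierpinski_Green k n"
  have diag: "(\<Sum>p\<in>?V'. ?g (butlast p) (butlast p)) = real k * t n"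
    by (simp add: sum_sierpinski_vertices_Suc t_def flip: sum_distrib_left)
  have diag': "(\<Sum>p\<in>?V'. ?g (butlast (bridge p)) (butlast (bridge p))) = real k * t n"
    unfolding diag[symmetric] by (rule sum_sierpinski_vertices_bridge)
  have cross: "(\<Sum>p\<in>?V'. ?g (butlast (bridge p)) (butlast p)) = real k * t n - (real k ^ n - 1)"
  proof -
    \<comment> \<open>Contraction gives the Laplacian of the column of \<open>p\<close> at
      \<open>p\<close> itself, which is \<open>1 - 1 / k ^ n\<close>; over all \<open>k ^ n\<close>
      vertices this adds up to \<open>k ^ n - 1\<close>.\<close>
    have "(\<Sum>a=1..k. ?g (butlast (bridge (p @ [a]))) p) = real k * ?g p p - (1 - 1 / real k ^ n)"
      if "p \<in> ?V" for p
      using sierpinski_laplacian_contract[OF that, of "\<lambda>r. ?g r p"]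
        sierpinski_laplacian_Green[OF assms(1) that that]
      by (simp add: sum_subtractf)
    then have "(\<Sum>p\<in>?V'. ?g (butlast (bridge p)) (butlast p))
        = (\<Sum>p\<in>?V. real k * ?g p p - (1 - 1 / real k ^ n))"
      by (simp add: sum_sierpinski_vertices_Suc)
    also have "\<dots> = real k * t n - (real k ^ n - 1)"
      using k by (simp add: t_def sum_subtractf card_sierpinski_vertices sum_distrib_left
          right_diff_distrib)
    finally show ?thesis .
  qed
  \<comment> \<open>Substituting \<open>bridge p\<close> for \<open>p\<close> exchanges the two
    arguments.\<close>
  have cross': "(\<Sum>p\<in>?V'. ?g (butlast p) (butlast (bridge p))) = real k * t n - (real k ^ n - 1)"
    unfolding cross[symmetric]
    using sum_sierpinski_vertices_bridge[of "\<lambda>p. ?g (butlast p) (butlast (bridge p))" "Suc n" k]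
    by simp
  have fixed: "(\<Sum>p\<in>?V'. of_bool (bridge p = p)) = real k"
    using card_bridge_fixed[of n k] by (simp add: of_bool_def flip: sum.inter_filter)
  have "t (Suc n) = (\<Sum>p\<in>?V'. sierpinski_Green k (Suc n) p p)"
    by (simp only: t_def)
  also have "\<dots> = ((real k + 1) * real k ^ Suc n + real k
      + (real k + 1) * ((real k + 1) * (real k * t n) + (real k * t n - (real k ^ n - 1)))
      + ((real k + 1) * (real k * t n - (real k ^ n - 1)) + real k * t n)) / (real k * (real k + 2))"
    by (simp add: sum.distrib fixed diag diag' cross cross' card_sierpinski_vertices
        flip: sum_divide_distrib sum_distrib_left del: power_Suc)
  also have "\<dots> = (real k + 2) * t n
    + ((real k + 1) * real k ^ Suc n + real k - 2 * (real k + 1) * (real k ^ n - 1))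
      / (real k * (real k + 2))"
    using k by (simp add: divide_simps) (simp add: algebra_simps)
  finally show ?thesis .
qed

text \<open>Solves the trace recurrence: besides the homogeneous mode \<open>(k + 2) ^ n\<close>
  there are a constant and a multiple of \<open>k ^ n\<close>. The row sum is subtracted as
  \<open>network_coherence_Green\<close> requires.\<close>

lemma sum_sierpinski_Green_diag:
  assumes "1 \<le> k"
  shows "(\<Sum>p\<in>sierpinski_vertices n k. sierpinski_Green k n p p)
      - ((real k + 2) ^ n - 1) / (real k * (real k + 1))
    = ((real k ^ 2 + real k + 2) * (real k - 1) * (real k + 2) ^ n - 4 * real k)
        / (2 * real k * (real k + 1) * (real k + 2))
      - real k ^ n * (real k - 2) * (real k + 1) / (2 * real k * (real k + 2))"
proof (induction n)
  case 0
  show ?case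
    using assms by (simp add: divide_simps) (simp add: power2_eq_square algebra_simps)
next
  case (Suc n)
  \<comment> \<open>With the powers as atoms \<open>A\<close> and \<open>B\<close>, the induction
    step is an identity of rational functions.\<close>
  define x where "x = real k"
  define A where "A = (x + 2) ^ n"
  define B where "B = x ^ n"
  have x: "x > 0" using assms by (simp add: x_def)
  define t where "t = (\<Sum>p\<in>sierpinski_vertices n k. sierpinski_Green k n p p)"
  have t: "t = (A - 1) / (x * (x + 1))
     + ((x ^ 2 + x + 2) * (x - 1) * A - 4 * x) / (2 * x * (x + 1) * (x + 2))
      - B * (x - 2) * (x + 1) / (2 * x * (x + 2))"
    using Suc.IH by (simp add: t_def x_def A_def B_def)
  show ?case
    unfolding sum_sierpinski_Green_diag_Suc[OF assms] t_def[symmetric] x_def[symmetric] power_Suc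
      A_def[symmetric] B_def[symmetric]
    unfolding t using x by (simp add: divide_simps) (simp add: power2_eq_square algebra_simps)
qed

section \<open>Closed form of the coherence and its asymptotics\<close>

lemma network_coherence_sierpinski:
  assumes "1 \<le> k" "1 \<le> n"
  shows "network_coherence (sierpinski n k) =
      ((real k ^ 2 + real k + 2) * (real k - 1) * (real k + 2) ^ n - 4 * real k) /
        (4 * real k ^ (n + 1) * (real k + 1) * (real k + 2))
      - (real k - 2) * (real k + 1) / (4 * real k * (real k + 2))"
proof -
  interpret pair_graph "sierpinski n k" by (rule pair_graph_sierpinski)
  have verts: "pverts (sierpinski n k) = sierpinski_vertices n k"
    by (simp add: sierpinski_def)
  have ne: "sierpinski_vertices n k \<noteq> {}"
    using card_sierpinski_vertices[of n k] assms(1) by force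
  obtain m where m: "n = Suc m" using assms(2) by (cases n) auto
  define A where "A = (real k + 2) ^ n"
  define B where "B = real k ^ n"
  have pos: "B > 0" "real k > 0" using assms(1) by (auto simp: B_def)
  have "network_coherence (sierpinski n k)
      = ((\<Sum>p\<in>sierpinski_vertices n k. sierpinski_Green k n p p)
          - ((real k + 2) ^ n - 1) / (real k * (real k + 1))) / (2 * real (k ^ n))"
  proof -
    have "(\<Sum>q | (p, q) \<in> parcs (sierpinski n k). sierpinski_Green k n p r - sierpinski_Green k n q r)
        = (if p = r then 1 else 0) - 1 / real (k ^ n)"
      if "p \<in> sierpinski_vertices n k" "r \<in> sierpinski_vertices n k" for p r
      using sum_neighbours_sierpinski[of p m k "\<lambda>p. sierpinski_Green k n p r", folded m]
        sierpinski_laplacian_Green[OF assms(1) that] that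
      by (simp add: of_bool_def)
    then show ?thesis
      by (rule network_coherence_Green[of "sierpinski_Green k n",
            unfolded verts card_sierpinski_vertices, OF ne _ sum_sierpinski_Green_row[OF assms(1)]])
  qed
  also have "\<dots> = (((real k ^ 2 + real k + 2) * (real k - 1) * A - 4 * real k)
        / (2 * real k * (real k + 1) * (real k + 2))
      - B * (real k - 2) * (real k + 1) / (2 * real k * (real k + 2))) / (2 * B)"
    unfolding sum_sierpinski_Green_diag[OF assms(1)] by (simp add: A_def B_def)
  also have "\<dots> = ((real k ^ 2 + real k + 2) * (real k - 1) * A - 4 * real k) /
        (4 * (real k * B) * (real k + 1) * (real k + 2))
      - (real k - 2) * (real k + 1) / (4 * real k * (real k + 2))"
  proof -
    obtain y z where "real k + 1 = y" "real k + 2 = z" by blast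
    then show ?thesis using pos by (simp add: diff_divide_distrib mult_ac)
  qed
  finally show ?thesis by (simp add: A_def B_def)
qed

text \<open>The exponent is chosen so that \<open>k\<close> raised to it is
  \<open>(k + 2) / k\<close>; the asymptotic formula is thus purely geometric in
  \<open>n\<close>.\<close>

lemma powr_log_quotient:
  assumes "2 \<le> k"
  shows "real (k ^ n) powr (ln (real k + 2) / ln (real k) - 1) = ((real k + 2) / real k) ^ n"
proof -
  have k: "real k > 1" using assms by simp
  have "real k powr (ln (real k + 2) / ln (real k) - 1) = exp (ln (real k + 2) - ln (real k))"
    using k by (simp add: powr_def field_simps)
  also have "\<dots> = (real k + 2) / real k"
    using k by (simp add: exp_diff)
  finally have base: "real k powr (ln (real k + 2) / ln (real k) - 1) = (real k + 2) / real k" .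
  have "real (k ^ n) powr (ln (real k + 2) / ln (real k) - 1)
      = (real k powr (ln (real k + 2) / ln (real k) - 1)) powr real n"
    using k by (simp add: powr_powr mult.commute flip: powr_realpow)
  then show ?thesis
    unfolding base using k by (simp add: powr_realpow)
qed

theorem theoremV3:
  fixes k :: nat
  assumes "k \<ge> 3"
  shows "(\<forall>n::nat. n \<ge> 1 \<longrightarrow>
            network_coherence (sierpinski n k) =
              ((real k ^ 2 + real k + 2) * (real k - 1) * (real k + 2) ^ n - 4 * real k) /
                (4 * real k ^ (n + 1) * (real k + 1) * (real k + 2))
              - (real k - 2) * (real k + 1) / (4 * real k * (real k + 2))) \<and>
         (\<lambda>n::nat. network_coherence (sierpinski n k)) \<sim>[sequentially]
           (\<lambda>n. (real k ^ 3 + real k - 2) / (4 * real k * (real k + 1) * (real k + 2)) *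
                 real (k ^ n) powr (ln (real k + 2) / ln (real k) - 1))"
proof (intro conjI allI impI)
  fix n :: nat
  assume "1 \<le> n"
  then show "network_coherence (sierpinski n k) =
      ((real k ^ 2 + real k + 2) * (real k - 1) * (real k + 2) ^ n - 4 * real k) /
        (4 * real k ^ (n + 1) * (real k + 1) * (real k + 2))
      - (real k - 2) * (real k + 1) / (4 * real k * (real k + 2))"
    using assms by (intro network_coherence_sierpinski) auto
next
  define x where "x = real k"
  have x: "x \<ge> 3" using assms by (simp add: x_def)
  define C where "C = (x ^ 3 + x - 2) / (4 * x * (x + 1) * (x + 2))"
  have C: "C > 0"
  proof -
    have "x ^ 3 + x - 2 > 0" using x zero_less_power[of x 3] by linarith
    then show ?thesis unfolding C_def using x by (intro divide_pos_pos mult_pos_pos) simp_all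
  qed
  define D where "D = (x - 2) * (x + 1) / (4 * x * (x + 2))"
  define r where "r = (x + 2) / x"
  have r: "r > 1" using x by (simp add: r_def)
  \<comment> \<open>The closed form splits into a growing geometric term, a decaying one and the
    constant \<open>D\<close>.\<close>
  have eq: "network_coherence (sierpinski n k)
      = C * r ^ n - (1 / ((x + 1) * (x + 2)) * (1 / x) ^ n + D)" if "1 \<le> n" for n
  proof -
    obtain N y z where atoms: "x ^ 3 + x - 2 = N" "x + 1 = y" "x + 2 = z" by blast
    have "network_coherence (sierpinski n k) =
        ((x ^ 2 + x + 2) * (x - 1) * (x + 2) ^ n - 4 * x) / (4 * (x * x ^ n) * (x + 1) * (x + 2)) - D"
      using network_coherence_sierpinski[of k n] that assms by (simp add: x_def D_def)
    also have "(x ^ 2 + x + 2) * (x - 1) = x ^ 3 + x - 2"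
      by (simp add: power2_eq_square power3_eq_cube algebra_simps)
    finally show ?thesis
      unfolding C_def r_def atoms using x by (simp add: diff_divide_distrib power_divide mult_ac)
  qed
  define a where "a = 1 / ((x + 1) * (x + 2))"
  \<comment> \<open>Relative to \<open>C * r ^ n\<close> the remainder consists of geometric terms
    with ratios \<open>1 / (x + 2)\<close> and \<open>1 / r\<close>, both below 1.\<close>
  have "(\<lambda>n. - (a * (1 / x) ^ n + D)) \<in> o(\<lambda>n. C * r ^ n)"
  proof (rule smalloI_tendsto)
    have "(\<lambda>n. - (a / C * (1 / x / r) ^ n) - D / C * (1 / r) ^ n) \<longlonglongrightarrow> - (a / C * 0) - D / C * 0"
      using x r by (intro tendsto_intros LIMSEQ_power_zero) (auto simp: r_def)
    moreover have "- (a * (1 / x) ^ n + D) / (C * r ^ n)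
        = - (a / C * (1 / x / r) ^ n) - D / C * (1 / r) ^ n" for n
      by (simp add: power_divide power_mult_distrib add_divide_distrib diff_divide_distrib)
    ultimately show "(\<lambda>n. - (a * (1 / x) ^ n + D) / (C * r ^ n)) \<longlonglongrightarrow> 0"
      by simp
    show "\<forall>\<^sub>F n in sequentially. C * r ^ n \<noteq> 0"
      using C r by simp
  qed
  then have "(\<lambda>n. C * r ^ n - (1 / ((x + 1) * (x + 2)) * (1 / x) ^ n + D)) \<sim>[sequentially] (\<lambda>n. C * r ^ n)"
    by (intro smallo_imp_asymp_equiv) (simp add: a_def)
  then have "(\<lambda>n. network_coherence (sierpinski n k)) \<sim>[sequentially] (\<lambda>n. C * r ^ n)"
    \<comment> \<open>The closed form is available from \<open>n = 1\<close> on, which suffices for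
      a limit.\<close>
    by (rule asymp_equiv_transfer) (auto simp: eq eventually_at_top_linorder intro!: exI[of _ 1])
  then show "(\<lambda>n. network_coherence (sierpinski n k)) \<sim>[sequentially]
      (\<lambda>n. (real k ^ 3 + real k - 2) / (4 * real k * (real k + 1) * (real k + 2)) *
        real (k ^ n) powr (ln (real k + 2) / ln (real k) - 1))"
    using powr_log_quotient[of k] assms by (simp add: C_def r_def x_def)
qed

end
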